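(* Let $\mathcal{H}=([d],E)$ be a simple hypergraph with no isolated vertices. Then there is a constant $C_{\mathcal{H}}$, depending only on $\mathcal{H}$, such that for every integer $t\geq 0$ and every positive integer $n$, \[M(\mathcal C_t(\mathcal{H}),n)\leq C_{\mathcal{H}}\, n^{\rho^*(\mathcal{H})}.\] In particular, the upper bound $O_{\mathcal{H}}(n^{\rho^*(\mathcal{H})})$ does not depend on $t$.
   Context: A hypergraph is a pair (vertex set, edge set) where edges are subsets of the vertex set; it is simple if no edge is repeated; a vertex is isolated if it lies in no edge. For a hypergraph $\mathcal{H}=(V,E)$, the fractional edge-covering number $\rho^*(\mathcal{H})$ is the minimum of $\sum_{e\in E}w(e)$ over all $w:E\to\mathbb{R}_{\geq 0}$ with $\sum_{e\ni v}w(e)\geq 1$ for every $v\in V$. For a hypergraph $\mathcal{H}=([d],E)$ and integer $t\geq 0$, its $t$-th cone $\mathcal C_t(\mathcal{H})$ is the hypergraph on $[d+t]$ with edge set $\{e\cup\{d+1,\dots,d+t\}\mid e\in E\}$. For a hypergraph $\mathcal{H}'$ on $r$ vertices, $M(\mathcal{H}',n)$ denotes the maximum, over all hypergraphs $G$ (of arbitrary, possibly mixed, uniformity) with $n$ edges, of the number of $r$-element sets of vertices of $G$ whose induced subhypergraph in $G$ contains a copy of $\mathcal{H}'$. *)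

theory Defs
  imports Complex_Main "HOL-Library.Multiset" "HOL-Library.Extended_Real"
begin

text \<open>Edges form a multiset of vertex sets, so that a hypergraph may have repeated edges and
  being simple is a genuine restriction. Hypergraphs are finite; edges may have any sizes.\<close>

type_synonym 'a hypergraph = "'a set \<times> 'a set multiset"

abbreviation verts :: "'a hypergraph \<Rightarrow> 'a set" where
  "verts \<equiv> fst"

abbreviation edges :: "'a hypergraph \<Rightarrow> 'a set multiset" where
  "edges \<equiv> snd"

definition hypergraph :: "'a hypergraph \<Rightarrow> bool" where
  "hypergraph H \<longleftrightarrow> finite (verts H) \<and> (\<forall>e\<in>#edges H. e \<subseteq> verts H)"

definition simple :: "'a hypergraph \<Rightarrow> bool" where
  "simple H \<longleftrightarrow> (\<forall>e. count (edges H) e \<le> 1)"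

definition isolated :: "'a hypergraph \<Rightarrow> 'a \<Rightarrow> bool" where
  "isolated H v \<longleftrightarrow> v \<in> verts H \<and> (\<forall>e\<in>#edges H. v \<notin> e)"

definition fractional_edge_cover :: "'a hypergraph \<Rightarrow> ('a set \<Rightarrow> real) \<Rightarrow> bool" where
  "fractional_edge_cover H w \<longleftrightarrow>
     (\<forall>e\<in>#edges H. 0 \<le> w e) \<and>
     (\<forall>v\<in>verts H. 1 \<le> (\<Sum>e\<in>#filter_mset (\<lambda>e. v \<in> e) (edges H). w e))"

text \<open>The infimum is over a nonempty set if no vertex is isolated, is bounded below by 0, and is
  then attained (it is the value of a finite linear program), so it is the minimum.\<close>

definition fractional_edge_cover_number :: "'a hypergraph \<Rightarrow> real" where
  "fractional_edge_cover_number H =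
     Inf {(\<Sum>e\<in>#edges H. w e) | w. fractional_edge_cover H w}"

text \<open>Intended for hypergraphs with vertex set \<open>{1..d}\<close>.\<close>

definition cone :: "nat \<Rightarrow> nat hypergraph \<Rightarrow> nat hypergraph" where
  "cone t H = (let d = card (verts H) in
     ({1..d + t}, image_mset (\<lambda>e. e \<union> {d + 1..d + t}) (edges H)))"

definition induced :: "'a hypergraph \<Rightarrow> 'a set \<Rightarrow> 'a hypergraph" where
  "induced G S = (S, filter_mset (\<lambda>e. e \<subseteq> S) (edges G))"

definition contains_copy :: "'a hypergraph \<Rightarrow> 'b hypergraph \<Rightarrow> bool" where
  "contains_copy G H \<longleftrightarrow>
     (\<exists>f. inj_on f (verts H) \<and> f ` verts H \<subseteq> verts G \<and>
          image_mset ((`) f) (edges H) \<subseteq># edges G)"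

definition copy_sets :: "'a hypergraph \<Rightarrow> 'b hypergraph \<Rightarrow> 'a set set" where
  "copy_sets G H =
     {S. S \<subseteq> verts G \<and> card S = card (verts H) \<and> contains_copy (induced G S) H}"

text \<open>Every finite hypergraph is isomorphic to one on natural numbers. The supremum is taken in
  \<^typ>\<open>enat\<close>: if it is finite it is a maximum, and if the counts are unbounded it is \<open>\<infinity>\<close>.\<close>

definition max_copies :: "'b hypergraph \<Rightarrow> nat \<Rightarrow> enat" where
  "max_copies H n =
     (SUP G \<in> {G :: nat hypergraph. hypergraph G \<and> size (edges G) = n}.
        enat (card (copy_sets G H)))"

end

theory Submission
  imports
    "HOL-Probability.Product_PMF"
    Defs (* last, so that cone is not shadowed by Convex.cone *)
begin

text \<open>
  Choose one embedding for each copy, so that a copy is \<open>S = T S \<union> f S ` [d]\<close> and each edge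
  \<open>e\<close> of \<open>H\<close> gives the edge \<open>X\<^sub>e = T S \<union> f S ` e\<close> of \<open>G\<close>. Shearer's inequality for the labels
  \<open>f S i\<close> does not apply directly, since \<open>X\<^sub>e\<close> does not determine which of its vertices carry
  labels. It does so up to \<open>O(ln D)\<close> nats relative to a reference set \<open>R\<close> such that \<open>S - R\<close> and \<open>R - S\<close>
  have size at most \<open>D\<close>. This gives, with \<open>\<rho>\<close> the total weight of a fractional cover \<open>w\<close> and
  \<open>M\<close> the set \<open>T S\<close> together with the labelled vertices in \<open>R\<close>,
  \<open>H(S | R) \<le> (\<Sum>e. w e * H(X\<^sub>e | R)) - (\<rho> - 1) * H(M | R) + O(ln D)\<close>.

  Let \<open>S\<close> be uniform and couple it with \<open>R\<close> so that \<open>H(S | R) - c * ln D\<close> is nearly maximal.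
  Resampling \<open>S\<close> given \<open>X\<^sub>e\<close> is no improvement, so
  \<open>H(X\<^sub>e | R) \<le> H(S | R) - H(S) + H(X\<^sub>e) + O(1)\<close>. Replacing \<open>R\<close> by \<open>M\<close>, which is within
  \<open>d\<close> of \<open>S\<close>, is no improvement either, so \<open>H(M | R) \<ge> c * ln D - O(1)\<close>, and for large \<open>c\<close> this
  absorbs the error term. What remains is \<open>H(S) \<le> \<rho> * ln n + O(1)\<close>. This needs \<open>\<rho>\<close> bounded away
  from 1, which holds unless \<open>[d]\<close> is an edge of \<open>H\<close>, and then every copy is an edge of \<open>G\<close>.
\<close>

section \<open>Entropy of finitely supported distributions\<close>

definition pmf_entropy :: "'a pmf \<Rightarrow> real" where
  "pmf_entropy p = measure_pmf.expectation p (\<lambda>x. - ln (pmf p x))"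

abbreviation entropy_of :: "('a \<Rightarrow> 'b) \<Rightarrow> 'a pmf \<Rightarrow> real" where
  "entropy_of X p \<equiv> pmf_entropy (map_pmf X p)"

lemma expectation_mono_pmf:
  fixes f g :: "'a \<Rightarrow> real"
  assumes "finite (set_pmf p)" and "\<And>x. x \<in> set_pmf p \<Longrightarrow> f x \<le> g x"
  shows "measure_pmf.expectation p f \<le> measure_pmf.expectation p g"
  using assms
  by (intro integral_mono_AE integrable_measure_pmf_finite) (auto simp: AE_measure_pmf_iff)

lemma expectation_cong_pmf:
  fixes f g :: "'a \<Rightarrow> real"
  assumes "\<And>x. x \<in> set_pmf p \<Longrightarrow> f x = g x"
  shows "measure_pmf.expectation p f = measure_pmf.expectation p g"
  using assms by (intro integral_cong_AE) (auto simp: AE_measure_pmf_iff)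

lemma pmf_le_pmf_map: "pmf p x \<le> pmf (map_pmf f p) (f x)"
  by (simp add: pmf_map pmf.rep_eq) (intro measure_pmf.finite_measure_mono, auto)

lemma entropy_of_le_pmf_entropy:
  assumes "finite (set_pmf p)"
  shows "entropy_of f p \<le> pmf_entropy p"
  unfolding pmf_entropy_def integral_map_pmf
  using assms by (intro expectation_mono_pmf) (auto intro!: ln_mono pmf_le_pmf_map pmf_positive)

text \<open>Relative entropy is nonnegative: average \<open>ln x <= x - 1\<close> at the ratios
  \<open>s x / pmf p x\<close>. The entropy bounds below come from choices of the trial weights
  \<open>s\<close>.\<close>

lemma gibbs_inequality:
  assumes fin: "finite (set_pmf p)"
    and pos: "\<And>x. x \<in> set_pmf p \<Longrightarrow> 0 < s x"
    and sub: "(\<Sum>x\<in>set_pmf p. s x) \<le> 1"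
  shows "pmf_entropy p \<le> measure_pmf.expectation p (\<lambda>x. - ln (s x))"
proof -
  have int: "integrable p f" for f :: "'a \<Rightarrow> real"
    using fin by (rule integrable_measure_pmf_finite)
  have "pmf_entropy p - measure_pmf.expectation p (\<lambda>x. - ln (s x))
      = measure_pmf.expectation p (\<lambda>x. ln (s x) - ln (pmf p x))"
    unfolding pmf_entropy_def by (simp add: int)
  also have "\<dots> \<le> measure_pmf.expectation p (\<lambda>x. s x / pmf p x - 1)"
  proof (rule expectation_mono_pmf[OF fin])
    fix x assume x: "x \<in> set_pmf p"
    then have "ln (s x) - ln (pmf p x) = ln (s x / pmf p x)"
      using pos[OF x] pmf_positive[OF x] by (simp add: ln_div)
    also have "\<dots> \<le> s x / pmf p x - 1"
      using x pos by (intro ln_le_minus_one) (simp add: pmf_positive)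
    finally show "ln (s x) - ln (pmf p x) \<le> s x / pmf p x - 1" .
  qed
  also have "\<dots> = measure_pmf.expectation p (\<lambda>x. s x / pmf p x) - 1"
    by (simp add: int)
  also have "measure_pmf.expectation p (\<lambda>x. s x / pmf p x)
      = (\<Sum>x\<in>set_pmf p. s x / pmf p x * pmf p x)"
    using fin by (intro integral_measure_pmf_real) auto
  also have "\<dots> = (\<Sum>x\<in>set_pmf p. s x)"
  proof (rule sum.cong[OF refl])
    fix x assume "x \<in> set_pmf p"
    then have "0 < pmf p x"
      by (rule pmf_positive)
    then show "s x / pmf p x * pmf p x = s x"
      by simp
  qed
  finally show ?thesis
    using sub by linarith
qed

lemma pmf_map_pos: "x \<in> set_pmf p \<Longrightarrow> 0 < pmf (map_pmf f p) (f x)"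
  by (simp add: pmf_positive)

text \<open>This is H(X | Y) <= ln K. The trial weights for the pair give a share 1/K of the mass of
  each value y of \<open>Y\<close> to each of the at most \<open>K\<close> values of
  \<open>X\<close> compatible with y.\<close>

lemma entropy_of_le_fibers:
  fixes X :: "'a \<Rightarrow> 'b" and Y :: "'a \<Rightarrow> 'c"
  assumes fin: "finite (set_pmf p)" and K: "0 < K"
    and fib: "\<And>w. w \<in> set_pmf p \<Longrightarrow> card (X ` {w' \<in> set_pmf p. Y w' = Y w}) \<le> K"
  shows "entropy_of X p \<le> entropy_of Y p + ln (real K)"
proof -
  define Z where "Z = (\<lambda>w. (X w, Y w))"
  define q where "q = map_pmf Z p"
  define s :: "'b \<times> 'c \<Rightarrow> real" where "s = (\<lambda>z. pmf (map_pmf Y p) (snd z) / real K)"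
  have finq: "finite (set_pmf q)" and setq: "set_pmf q = Z ` set_pmf p"
    using fin by (auto simp: q_def)
  have "entropy_of X p = entropy_of fst q"
    by (simp add: q_def map_pmf_comp Z_def)
  also have "\<dots> \<le> pmf_entropy q"
    using finq by (rule entropy_of_le_pmf_entropy)
  also have "\<dots> \<le> measure_pmf.expectation q (\<lambda>z. - ln (s z))"
  proof (rule gibbs_inequality[OF finq])
    fix z assume "z \<in> set_pmf q"
    then show "0 < s z"
      using K by (auto simp: s_def setq Z_def pmf_positive)
  next
    have "(\<Sum>z\<in>set_pmf q. s z)
        = (\<Sum>y\<in>Y ` set_pmf p. \<Sum>z\<in>{z \<in> set_pmf q. snd z = y}. s z)"
      using finq fin by (intro sum.group[symmetric]) (auto simp: setq Z_def)
    also have "\<dots> \<le> (\<Sum>y\<in>Y ` set_pmf p. pmf (map_pmf Y p) y)"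
    proof (rule sum_mono)
      fix y assume "y \<in> Y ` set_pmf p"
      then obtain w where w: "w \<in> set_pmf p" "y = Y w" by auto
      have "card {z \<in> set_pmf q. snd z = y} = card (fst ` {z \<in> set_pmf q. snd z = y})"
        by (intro card_image[symmetric]) (auto simp: inj_on_def)
      also have "fst ` {z \<in> set_pmf q. snd z = y} = X ` {w' \<in> set_pmf p. Y w' = Y w}"
        by (force simp: setq Z_def w)
      also have "card \<dots> \<le> K"
        using fib[OF w(1)] .
      finally have "real (card {z \<in> set_pmf q. snd z = y}) / real K \<le> 1"
        using K by simp
      then have "pmf (map_pmf Y p) y * (real (card {z \<in> set_pmf q. snd z = y}) / real K)
          \<le> pmf (map_pmf Y p) y * 1"
        by (intro mult_left_mono) auto
      then show "(\<Sum>z\<in>{z \<in> set_pmf q. snd z = y}. s z) \<le> pmf (map_pmf Y p) y"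
        by (simp add: s_def mult.commute)
    qed
    also have "\<dots> = 1"
      using fin by (intro sum_pmf_eq_1) auto
    finally show "(\<Sum>z\<in>set_pmf q. s z) \<le> 1" .
  qed
  also have "\<dots> = measure_pmf.expectation p (\<lambda>w. - ln (pmf (map_pmf Y p) (Y w)) + ln (real K))"
    unfolding q_def integral_map_pmf
  proof (rule expectation_cong_pmf)
    fix w assume "w \<in> set_pmf p"
    then show "- ln (s (Z w)) = - ln (pmf (map_pmf Y p) (Y w)) + ln (real K)"
      using K pmf_map_pos[of w p Y] by (simp add: s_def Z_def ln_div)
  qed
  also have "\<dots> = entropy_of Y p + ln (real K)"
    using fin by (simp add: pmf_entropy_def integrable_measure_pmf_finite)
  finally show ?thesis .
qed

lemma entropy_of_le_determined:
  assumes "finite (set_pmf p)"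
    and "\<And>w w'. w \<in> set_pmf p \<Longrightarrow> w' \<in> set_pmf p \<Longrightarrow> Y w = Y w' \<Longrightarrow> X w = X w'"
  shows "entropy_of X p \<le> entropy_of Y p"
proof -
  have "entropy_of X p \<le> entropy_of Y p + ln (real 1)"
  proof (rule entropy_of_le_fibers)
    fix w assume "w \<in> set_pmf p"
    then have "X ` {w' \<in> set_pmf p. Y w' = Y w} = {X w}"
      using assms(2) by blast
    then show "card (X ` {w' \<in> set_pmf p. Y w' = Y w}) \<le> 1"
      by simp
  qed (use assms in auto)
  then show ?thesis
    by simp
qed

lemma pmf_entropy_return [simp]: "pmf_entropy (return_pmf c) = 0"
  by (simp add: pmf_entropy_def)

lemma pmf_entropy_le_ln_card:
  assumes "finite A" and "set_pmf p \<subseteq> A"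
  shows "pmf_entropy p \<le> ln (real (card A))"
proof -
  have fin: "finite (set_pmf p)"
    using assms finite_subset by blast
  have "entropy_of (\<lambda>w. w) p \<le> entropy_of (\<lambda>_. ()) p + ln (real (card A))"
  proof (rule entropy_of_le_fibers[OF fin])
    show "0 < card A"
      using assms set_pmf_not_empty[of p] by (auto simp: card_gt_0_iff)
    show "card ((\<lambda>w. w) ` {w' \<in> set_pmf p. () = ()}) \<le> card A" for w
      using assms by (auto intro: card_mono)
  qed
  then show ?thesis
    by simp
qed

text \<open>Here \<open>Z\<close> is a function of \<open>X\<close> and also of \<open>Y\<close>,
  and the claim is I(X; Y | Z) >= 0. The trial weights are the law with the same marginals that
  makes \<open>X\<close> and \<open>Y\<close> independent given \<open>Z\<close>.\<close>

lemma entropy_of_submodular: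
  assumes fin: "finite (set_pmf p)"
    and Zu: "\<And>w. w \<in> set_pmf p \<Longrightarrow> Z w = u (X w)"
    and Zv: "\<And>w. w \<in> set_pmf p \<Longrightarrow> Z w = v (Y w)"
  shows "entropy_of (\<lambda>w. (X w, Y w)) p + entropy_of Z p \<le> entropy_of X p + entropy_of Y p"
proof -
  define q where "q = map_pmf (\<lambda>w. (X w, Y w)) p"
  define A where "A = X ` set_pmf p"
  define B where "B = Y ` set_pmf p"
  define C where "C = Z ` set_pmf p"
  have finq: "finite (set_pmf q)"
    and setq: "set_pmf q = (\<lambda>w. (X w, Y w)) ` set_pmf p"
    and fins: "finite A" "finite B" "finite C"
    using fin by (auto simp: q_def A_def B_def C_def)
  define PX where "PX = pmf (map_pmf X p)"
  define PY where "PY = pmf (map_pmf Y p)"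
  define PZ where "PZ = pmf (map_pmf Z p)"
  have PX_sum: "(\<Sum>x\<in>{x \<in> A. u x = z}. PX x) = PZ z" for z
  proof -
    have "PZ z = pmf (map_pmf u (map_pmf X p)) z"
      unfolding PZ_def by (simp add: map_pmf_comp Zu cong: map_pmf_cong)
    also have "\<dots> = measure (map_pmf X p) (u -` {z})"
      by (rule pmf_map)
    also have "\<dots> = measure (map_pmf X p) {x \<in> A. u x = z}"
      by (intro measure_prob_cong_0) (auto simp: A_def pmf_eq_0_set_pmf)
    also have "\<dots> = (\<Sum>x\<in>{x \<in> A. u x = z}. PX x)"
      unfolding PX_def using fins by (intro measure_measure_pmf_finite) simp
    finally show ?thesis ..
  qed
  have PY_sum: "(\<Sum>y\<in>{y \<in> B. v y = z}. PY y) = PZ z" for z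
  proof -
    have "PZ z = pmf (map_pmf v (map_pmf Y p)) z"
      unfolding PZ_def by (simp add: map_pmf_comp Zv cong: map_pmf_cong)
    also have "\<dots> = measure (map_pmf Y p) (v -` {z})"
      by (rule pmf_map)
    also have "\<dots> = measure (map_pmf Y p) {y \<in> B. v y = z}"
      by (intro measure_prob_cong_0) (auto simp: B_def pmf_eq_0_set_pmf)
    also have "\<dots> = (\<Sum>y\<in>{y \<in> B. v y = z}. PY y)"
      unfolding PY_def using fins by (intro measure_measure_pmf_finite) simp
    finally show ?thesis ..
  qed
  define s where "s = (\<lambda>(x, y). PX x * PY y / PZ (u x))"
  have pos: "0 < PX (X w)" "0 < PY (Y w)" "0 < PZ (u (X w))" if "w \<in> set_pmf p" for w
    using that pmf_map_pos[of w p X] pmf_map_pos[of w p Y] pmf_map_pos[of w p Z]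
    by (auto simp: PX_def PY_def PZ_def Zu)
  have snn: "0 \<le> s xy" for xy
    by (auto simp: s_def PX_def PY_def PZ_def split: prod.split)
  \<comment> \<open>Only pairs with \<open>u x = v y\<close> occur; \<open>T\<close> groups them by
    this common value, and the sum of \<open>s\<close> factorizes over each group.\<close>
  define T where "T = (SIGMA z:C. {x \<in> A. u x = z} \<times> {y \<in> B. v y = z})"
  have "pmf_entropy q \<le> measure_pmf.expectation q (\<lambda>z. - ln (s z))"
  proof (rule gibbs_inequality[OF finq])
    fix z assume "z \<in> set_pmf q"
    then show "0 < s z"
      using pos by (auto simp: s_def setq)
  next
    have injT: "inj_on snd T"
      by (auto simp: T_def inj_on_def)
    have "set_pmf q \<subseteq> snd ` T"
    proof
      fix xy assume "xy \<in> set_pmf q"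
      then obtain w where w: "w \<in> set_pmf p" "xy = (X w, Y w)"
        by (auto simp: setq)
      then have "Z w \<in> C" "X w \<in> A" "Y w \<in> B"
        by (auto simp: A_def B_def C_def)
      then have "(Z w, xy) \<in> T"
        using Zu[OF w(1)] Zv[OF w(1)] by (simp add: T_def w(2))
      then show "xy \<in> snd ` T"
        by force
    qed
    moreover have "finite T"
      using fins by (auto simp: T_def)
    ultimately have "(\<Sum>xy\<in>set_pmf q. s xy) \<le> (\<Sum>xy\<in>snd ` T. s xy)"
      using snn by (intro sum_mono2) auto
    also have "\<dots> = (\<Sum>t\<in>T. s (snd t))"
      by (simp add: sum.reindex[OF injT])
    also have "\<dots> = (\<Sum>(z, xy)\<in>T. s xy)"
      by (intro sum.cong) auto
    also have "\<dots> = (\<Sum>z\<in>C. \<Sum>xy\<in>{x \<in> A. u x = z} \<times> {y \<in> B. v y = z}. s xy)"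
      unfolding T_def using fins by (intro sum.Sigma[symmetric]) auto
    also have "\<dots> = (\<Sum>z\<in>C. PZ z)"
    proof (rule sum.cong[OF refl])
      fix z assume "z \<in> C"
      then have z: "0 < PZ z"
        using pos Zu by (auto simp: C_def)
      have "(\<Sum>xy\<in>{x \<in> A. u x = z} \<times> {y \<in> B. v y = z}. s xy)
          = (\<Sum>x\<in>{x \<in> A. u x = z}. \<Sum>y\<in>{y \<in> B. v y = z}. PX x * PY y / PZ z)"
        by (simp add: sum.cartesian_product' s_def)
      also have "\<dots> = (\<Sum>x\<in>{x \<in> A. u x = z}. PX x) * (\<Sum>y\<in>{y \<in> B. v y = z}. PY y) / PZ z"
        by (simp add: sum_product sum_divide_distrib)
      also have "\<dots> = PZ z"
        using z by (simp add: PX_sum PY_sum)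
      finally show "(\<Sum>xy\<in>{x \<in> A. u x = z} \<times> {y \<in> B. v y = z}. s xy) = PZ z" .
    qed
    also have "\<dots> = 1"
      unfolding PZ_def C_def using fin by (intro sum_pmf_eq_1) auto
    finally show "(\<Sum>xy\<in>set_pmf q. s xy) \<le> 1" .
  qed
  also have "\<dots> = measure_pmf.expectation p
      (\<lambda>w. - ln (PX (X w)) + - ln (PY (Y w)) - - ln (PZ (Z w)))"
    unfolding q_def integral_map_pmf
  proof (rule expectation_cong_pmf)
    fix w assume w: "w \<in> set_pmf p"
    then have "ln (s (X w, Y w)) = ln (PX (X w)) + ln (PY (Y w)) - ln (PZ (u (X w)))"
      using pos[OF w] by (simp add: s_def ln_div ln_mult)
    then show "- ln (s (X w, Y w)) = - ln (PX (X w)) + - ln (PY (Y w)) - - ln (PZ (Z w))"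
      using Zu[OF w] by simp
  qed
  also have "\<dots> = entropy_of X p + entropy_of Y p - entropy_of Z p"
    using fin by (simp add: pmf_entropy_def integrable_measure_pmf_finite PX_def PY_def PZ_def)
  finally show ?thesis
    by (simp add: q_def)
qed

section \<open>Resampling the first component of a pair\<close>

text \<open>The new \<open>s\<close> is drawn from the first marginal conditioned on
  \<open>X s\<close> alone, so it depends on \<open>r\<close> only through
  \<open>X s\<close>.\<close>

definition resample :: "('a \<Rightarrow> 'c) \<Rightarrow> ('a \<times> 'b) pmf \<Rightarrow> ('a \<times> 'b) pmf" where
  "resample X q = bind_pmf (map_pmf (map_prod X id) q)
     (\<lambda>(x, r). map_pmf (\<lambda>s. (s, r)) (cond_pmf (map_pmf fst q) {s. X s = x}))"

lemma resample_fiber_nonempty: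
  "(x, r) \<in> set_pmf (map_pmf (map_prod X id) q) \<Longrightarrow> set_pmf (map_pmf fst q) \<inter> {s. X s = x} \<noteq> {}"
  by force

lemma set_pmf_resample:
  "set_pmf (resample X q) =
     {(s', r) | s' s r. (s, r) \<in> set_pmf q \<and> s' \<in> fst ` set_pmf q \<and> X s' = X s}"
proof -
  have *: "set_pmf (cond_pmf (map_pmf fst q) {s. X s = X a}) = fst ` set_pmf q \<inter> {s. X s = X a}"
    if "(a, b) \<in> set_pmf q" for a b
    using resample_fiber_nonempty[of "X a" b X q] that by (subst set_cond_pmf) force+
  have "set_pmf (resample X q) =
      (\<Union>(s, r)\<in>set_pmf q. (\<lambda>s'. (s', r)) ` set_pmf (cond_pmf (map_pmf fst q) {s'. X s' = X s}))"
    unfolding resample_def by (simp add: split_def)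
  also have "\<dots> = (\<Union>(s, r)\<in>set_pmf q. (\<lambda>s'. (s', r)) ` (fst ` set_pmf q \<inter> {s'. X s' = X s}))"
    by (intro SUP_cong[OF refl]) (clarsimp simp: *)
  also have "\<dots> = {(s', r) | s' s r. (s, r) \<in> set_pmf q \<and> s' \<in> fst ` set_pmf q \<and> X s' = X s}"
    by blast
  finally show ?thesis .
qed

text \<open>Averaging the conditional laws of \<open>s\<close> given \<open>X s\<close> over the law
  of \<open>X s\<close> restores the law of \<open>s\<close>. Hence resampling keeps
  \<open>S\<close> uniform.\<close>

lemma map_fst_resample: "map_pmf fst (resample X q) = map_pmf fst q"
proof -
  let ?p = "map_pmf fst q"
  have "map_pmf fst (resample X q) =
      bind_pmf (map_pmf (map_prod X id) q) (\<lambda>(x, r). cond_pmf ?p {s. X s = x})"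
    unfolding resample_def by (auto simp: map_bind_pmf map_pmf_comp split_def intro!: bind_pmf_cong)
  also have "\<dots> = bind_pmf (map_pmf X ?p) (\<lambda>x. cond_pmf ?p {s. X s = x})"
    by (simp add: bind_map_pmf split_def)
  also have "\<dots> = ?p"
  proof (rule bind_cond_pmf_cancel)
    fix x y assume "x \<in> set_pmf (map_pmf X ?p)" "y \<in> set_pmf ?p" "X y = x"
    then have "measure (map_pmf X ?p) {x. X y = x} = measure ?p (X -` {x. X y = x})"
      by (simp add: measure_map_pmf)
    also have "X -` {x. X y = x} = {y. X y = x}"
      using \<open>X y = x\<close> by auto
    finally show "measure ?p {y. X y = x} = measure (map_pmf X ?p) {x. X y = x}" ..
  qed auto
  finally show ?thesis .
qed

text \<open>Of all components of the mixture, only the one at \<open>(X s, r)\<close> can produce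
  \<open>(s, r)\<close>.\<close>

lemma pmf_resample:
  assumes "finite (set_pmf q)" and "s \<in> fst ` set_pmf q"
  shows "pmf (resample X q) (s, r) =
    pmf (map_pmf (map_prod X id) q) (X s, r) * pmf (map_pmf fst q) s
      / pmf (map_pmf X (map_pmf fst q)) (X s)"
proof -
  let ?p = "map_pmf fst q" and ?m = "map_pmf (map_prod X id) q"
  let ?f = "\<lambda>(x, r). map_pmf (\<lambda>s. (s, r)) (cond_pmf ?p {s. X s = x})"
  have "pmf (resample X q) (s, r) = measure_pmf.expectation ?m (\<lambda>xr. pmf (?f xr) (s, r))"
    unfolding resample_def by (rule pmf_bind)
  also have "\<dots> = (\<Sum>xr\<in>{(X s, r)}. pmf (?f xr) (s, r) * pmf ?m xr)"
  proof (rule integral_measure_pmf_real)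
    fix xr assume xr: "xr \<in> set_pmf ?m" and "pmf (?f xr) (s, r) \<noteq> 0"
    then have "(s, r) \<in> set_pmf (?f xr)"
      by (simp add: set_pmf_iff)
    then show "xr \<in> {(X s, r)}"
      using set_cond_pmf[OF resample_fiber_nonempty[of "fst xr" "snd xr" X q]] xr
      by (cases xr) auto
  qed simp
  also have "\<dots> = pmf (?f (X s, r)) (s, r) * pmf ?m (X s, r)"
    by simp
  also have "pmf (?f (X s, r)) (s, r) = pmf (cond_pmf ?p {s'. X s' = X s}) s"
    using pmf_map_inj'[of "\<lambda>s. (s, r)"] by (simp add: inj_on_def)
  also have "\<dots> = pmf ?p s / measure ?p {s'. X s' = X s}"
    using assms by (subst pmf_cond) auto
  also have "measure ?p {s'. X s' = X s} = pmf (map_pmf X ?p) (X s)"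
    by (simp add: pmf_map[of X] vimage_def)
  finally show ?thesis
    by (simp only: times_divide_eq_left mult.commute[of "pmf ?p s"])
qed

text \<open>This is the chain rule: \<open>R\<close> and the new \<open>S\<close> are independent given \<open>X S\<close>.\<close>

lemma pmf_entropy_resample:
  assumes fin: "finite (set_pmf q)"
  shows "pmf_entropy (resample X q) =
    entropy_of (map_prod X id) q + entropy_of fst q - entropy_of (X \<circ> fst) q"
proof -
  let ?q = "resample X q" and ?p = "map_pmf fst q" and ?m = "map_pmf (map_prod X id) q"
  have sub: "set_pmf ?q \<subseteq> fst ` set_pmf q \<times> snd ` set_pmf q"
    unfolding set_pmf_resample by force
  then have fin': "finite (set_pmf ?q)"
    by (rule finite_subset) (use fin in auto)
  have mq: "map_pmf (map_prod X id) ?q = ?m"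
  proof -
    have "map_pmf (map_prod X id) ?q = bind_pmf ?m (\<lambda>xr. return_pmf xr)"
      unfolding resample_def map_bind_pmf
    proof (rule bind_pmf_cong[OF refl])
      fix xr assume xr: "xr \<in> set_pmf ?m"
      obtain x r where xr_eq: "xr = (x, r)" by (cases xr)
      have "map_pmf (\<lambda>s. (X s, r)) (cond_pmf ?p {s. X s = x})
          = map_pmf (\<lambda>s. (x, r)) (cond_pmf ?p {s. X s = x})"
        using set_cond_pmf[OF resample_fiber_nonempty[of x r X q]] xr
        by (intro map_pmf_cong) (auto simp: xr_eq)
      then show "map_pmf (map_prod X id)
          (case xr of (x, r) \<Rightarrow> map_pmf (\<lambda>s. (s, r)) (cond_pmf ?p {s. X s = x})) = return_pmf xr"
        by (simp add: xr_eq map_pmf_comp map_pmf_const)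
    qed
    then show ?thesis
      by (simp add: bind_return_pmf')
  qed
  have "pmf_entropy ?q = measure_pmf.expectation ?q
     (\<lambda>sr. - ln (pmf ?m (map_prod X id sr)) + - ln (pmf ?p (fst sr))
        - - ln (pmf (map_pmf X ?p) (X (fst sr))))"
    unfolding pmf_entropy_def
  proof (rule expectation_cong_pmf)
    fix sr assume sr: "sr \<in> set_pmf ?q"
    obtain s r where sr_eq: "sr = (s, r)" by (cases sr)
    have s: "s \<in> fst ` set_pmf q"
      using sr sub by (auto simp: sr_eq)
    have "(X s, r) \<in> set_pmf ?m"
      using sr unfolding sr_eq set_pmf_resample by force
    then have "0 < pmf ?m (X s, r)"
      by (rule pmf_positive)
    moreover have "0 < pmf ?p s" and "0 < pmf (map_pmf X ?p) (X s)"
      using s by (simp_all add: pmf_positive)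
    ultimately show "- ln (pmf ?q sr) = - ln (pmf ?m (map_prod X id sr)) + - ln (pmf ?p (fst sr))
        - - ln (pmf (map_pmf X ?p) (X (fst sr)))"
      by (simp add: sr_eq pmf_resample[OF fin s] ln_div ln_mult)
  qed
  also have "\<dots> = measure_pmf.expectation (map_pmf (map_prod X id) ?q) (\<lambda>z. - ln (pmf ?m z))
      + measure_pmf.expectation (map_pmf fst ?q) (\<lambda>s. - ln (pmf ?p s))
      - measure_pmf.expectation (map_pmf fst ?q) (\<lambda>s. - ln (pmf (map_pmf X ?p) (X s)))"
    using fin' by (simp add: integrable_measure_pmf_finite)
  also have "\<dots> = entropy_of (map_prod X id) q + entropy_of fst q - entropy_of (X \<circ> fst) q"
    unfolding mq map_fst_resample pmf_entropy_def
    by (simp add: map_pmf_comp o_def)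
  finally show ?thesis .
qed

lemma map_snd_resample: "map_pmf snd (resample X q) = map_pmf snd q"
  unfolding resample_def
  by (simp add: map_bind_pmf map_pmf_comp split_def map_pmf_const bind_map_pmf flip: map_pmf_def)

lemma pmf_entropy_pmf_of_set:
  assumes "finite A" "A \<noteq> {}"
  shows "pmf_entropy (pmf_of_set A) = ln (real (card A))"
proof -
  have "pmf_entropy (pmf_of_set A) = measure_pmf.expectation (pmf_of_set A) (\<lambda>_. ln (real (card A)))"
    unfolding pmf_entropy_def using assms by (intro expectation_cong_pmf) (simp add: ln_div)
  then show ?thesis
    by simp
qed

section \<open>Families of sets with labelled vertices\<close>

text \<open>Add the elements of \<open>I\<close> one at a time. When i in e is added, submodularity
  makes the gain of \<open>F\<close> on the part of e seen so far at least the gain on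
  \<open>J\<close>, and the edges containing i have total weight at least 1. \<open>F\<close> is not
  normalized; the term in \<open>F {}\<close> will carry the entropy of the reference set and the
  core.\<close>

lemma polymatroid_shearer:
  fixes F :: "'i set \<Rightarrow> real"
  assumes fin: "finite I"
    and E: "\<And>e. e \<in> E \<Longrightarrow> e \<subseteq> I"
    and w: "\<And>e. e \<in> E \<Longrightarrow> 0 \<le> w e"
    and finE: "finite E"
    and cover: "\<And>i. i \<in> I \<Longrightarrow> 1 \<le> (\<Sum>e\<in>{e \<in> E. i \<in> e}. w e)"
    and mono: "\<And>A B. A \<subseteq> B \<Longrightarrow> B \<subseteq> I \<Longrightarrow> F A \<le> F B"
    and submodular: "\<And>A B. A \<subseteq> I \<Longrightarrow> B \<subseteq> I \<Longrightarrow> F (A \<union> B) + F (A \<inter> B) \<le> F A + F B"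
  shows "F I + (sum w E - 1) * F {} \<le> (\<Sum>e\<in>E. w e * F e)"
proof -
  have "F J - F {} \<le> (\<Sum>e\<in>E. w e * (F (e \<inter> J) - F {}))" if "J \<subseteq> I" for J
    using finite_subset[OF that fin] that
  proof (induction J rule: finite_induct)
    case empty
    then show ?case by simp
  next
    case (insert i J)
    define g where "g = F (insert i J) - F J"
    have g: "0 \<le> g"
      using mono[of J "insert i J"] insert.prems by (auto simp: g_def)
    have step: "(if i \<in> e then w e * g else 0)
        \<le> w e * (F (e \<inter> insert i J) - F {}) - w e * (F (e \<inter> J) - F {})" if e: "e \<in> E" for e
    proof (cases "i \<in> e")
      case True
      have "F (e \<inter> insert i J \<union> J) + F (e \<inter> insert i J \<inter> J) \<le> F (e \<inter> insert i J) + F J"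
        using E[OF e] insert.prems by (intro submodular) auto
      moreover have "e \<inter> insert i J \<union> J = insert i J" "e \<inter> insert i J \<inter> J = e \<inter> J"
        using True by auto
      ultimately have "g \<le> F (e \<inter> insert i J) - F (e \<inter> J)"
        by (simp add: g_def)
      then have "w e * g \<le> w e * (F (e \<inter> insert i J) - F (e \<inter> J))"
        using w[OF e] by (intro mult_left_mono) auto
      then show ?thesis
        using True by (simp add: algebra_simps)
    qed auto
    have "g \<le> (\<Sum>e\<in>{e \<in> E. i \<in> e}. w e) * g"
      using mult_right_mono[OF cover g, of i] insert.prems by simp
    also have "\<dots> = (\<Sum>e\<in>E. if i \<in> e then w e * g else 0)"
      unfolding sum_distrib_right using finE by (rule sum.inter_filter)
    also have "\<dots> \<le> (\<Sum>e\<in>E. w e * (F (e \<inter> insert i J) - F {}) - w e * (F (e \<inter> J) - F {}))"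
      by (intro sum_mono step)
    finally show ?case
      using insert by (simp add: g_def sum_subtractf)
  qed
  from this[of I] have "F I - F {} \<le> (\<Sum>e\<in>E. w e * (F (e \<inter> I) - F {}))"
    by simp
  also have "\<dots> = (\<Sum>e\<in>E. w e * F e) - sum w E * F {}"
    using E by (simp add: Int_absorb2 right_diff_distrib sum_subtractf sum_distrib_right)
  finally show ?thesis
    by (simp add: algebra_simps)
qed

text \<open>For cones, \<open>I\<close> is [d], \<open>\<S>\<close> the set of copies,
  \<open>\<G>\<close> the set of edges of the host hypergraph, \<open>T S\<close> the image of the
  added vertices and \<open>f S\<close> the labelling. No bound on the size of \<open>T S\<close> is
  assumed, which is why t does not enter the estimates.\<close>

locale labelled_family =
  fixes I :: "'i set" and E :: "'i set set" and w :: "'i set \<Rightarrow> real"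
    and \<S> \<G> :: "'a set set" and T :: "'a set \<Rightarrow> 'a set" and f :: "'a set \<Rightarrow> 'i \<Rightarrow> 'a"
  assumes finite_I: "finite I" and finite_E: "finite E"
    and finite_S: "finite \<S>" and S_nonempty: "\<S> \<noteq> {}" and finite_G: "finite \<G>"
    and finite_member: "\<And>S. S \<in> \<S> \<Longrightarrow> finite S"
    and decomp: "\<And>S. S \<in> \<S> \<Longrightarrow> S = T S \<union> f S ` I"
    and notin_T: "\<And>S i. S \<in> \<S> \<Longrightarrow> i \<in> I \<Longrightarrow> f S i \<notin> T S"
    and E_sub: "\<And>e. e \<in> E \<Longrightarrow> e \<subseteq> I"
    and in_G: "\<And>S e. S \<in> \<S> \<Longrightarrow> e \<in> E \<Longrightarrow> T S \<union> f S ` e \<in> \<G>"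
    and w_nonneg: "\<And>e. e \<in> E \<Longrightarrow> 0 \<le> w e"
    and w_cover: "\<And>i. i \<in> I \<Longrightarrow> 1 \<le> (\<Sum>e\<in>{e \<in> E. i \<in> e}. w e)"
begin

definition edge :: "'i set \<Rightarrow> 'a set \<Rightarrow> 'a set" where
  "edge e S = T S \<union> f S ` e"

definition core :: "'a set \<Rightarrow> 'a set \<Rightarrow> 'a set" where
  "core S R = T S \<union> f S ` I \<inter> R"

text \<open>\<open>None\<close> marks indices outside \<open>J\<close> as well as labels inside
  \<open>R\<close>, so the function for a smaller \<open>J\<close> is a restriction of that for a
  larger one.\<close>

definition outer :: "'i set \<Rightarrow> 'a set \<Rightarrow> 'a set \<Rightarrow> 'i \<Rightarrow> 'a option" where
  "outer J S R i = (if i \<in> J \<and> f S i \<notin> R then Some (f S i) else None)"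

text \<open>Shearer's inequality is applied to its entropy as a function of \<open>J\<close>. The
  core shows all labelled vertices in \<open>R\<close> whatever \<open>J\<close> is, so the view for
  \<open>J = {}\<close> amounts to \<open>R\<close> and the core.\<close>

definition partial_view :: "'i set \<Rightarrow> 'a set \<times> 'a set \<Rightarrow> 'a set \<times> 'a set \<times> ('i \<Rightarrow> 'a option)" where
  "partial_view J = (\<lambda>(S, R). (R, core S R, outer J S R))"

definition coupling :: "nat \<Rightarrow> ('a set \<times> 'a set) pmf \<Rightarrow> bool" where
  "coupling D q \<longleftrightarrow> finite (set_pmf q) \<and> map_pmf fst q = pmf_of_set \<S> \<and>
     (\<forall>(S, R)\<in>set_pmf q. finite R \<and> card (S - R) \<le> D \<and> card (R - S) \<le> D)"

definition cond_entropy :: "('a set \<times> 'a set) pmf \<Rightarrow> real" where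
  "cond_entropy q = pmf_entropy q - entropy_of snd q"

section \<open>Distances between members, their edges and reference sets\<close>

lemma edge_subset: "S \<in> \<S> \<Longrightarrow> e \<in> E \<Longrightarrow> edge e S \<subseteq> S"
  using decomp[of S] E_sub[of e] unfolding edge_def by blast

lemma finite_edge: "S \<in> \<S> \<Longrightarrow> e \<in> E \<Longrightarrow> finite (edge e S)"
  using edge_subset finite_member finite_subset by blast

lemma coupling_finite: "coupling D q \<Longrightarrow> finite (set_pmf q)"
  by (simp add: coupling_def)

lemma coupling_fst: "coupling D q \<Longrightarrow> fst ` set_pmf q = \<S>"
  using finite_S S_nonempty by (simp add: coupling_def flip: set_map_pmf)

lemma coupling_memD:
  assumes "coupling D q" and "(S, R) \<in> set_pmf q"
  shows "S \<in> \<S>" "finite R" "card (S - R) \<le> D" "card (R - S) \<le> D"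
proof -
  show "S \<in> \<S>"
    using assms(2) by (auto simp flip: coupling_fst[OF assms(1)] intro!: image_eqI[where x = "(S, R)"])
  show "finite R" "card (S - R) \<le> D" "card (R - S) \<le> D"
    using assms by (auto simp: coupling_def)
qed

lemma entropy_fst: "coupling D q \<Longrightarrow> entropy_of fst q = ln (real (card \<S>))"
  using finite_S S_nonempty by (simp add: coupling_def pmf_entropy_pmf_of_set)

lemma card_diff_edge: "S \<in> \<S> \<Longrightarrow> card (S - edge e S) \<le> card I"
proof -
  assume "S \<in> \<S>"
  then have "S - edge e S \<subseteq> f S ` I"
    using decomp[of S] unfolding edge_def by blast
  then have "card (S - edge e S) \<le> card (f S ` I)"
    using finite_I by (intro card_mono) auto
  also have "\<dots> \<le> card I"
    using finite_I by (rule card_image_le)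
  finally show ?thesis .
qed

lemma card_sym_diff_edge:
  assumes "coupling D q" "(S, R) \<in> set_pmf q" "e \<in> E"
  shows "card (edge e S - R) \<le> D" "card (R - edge e S) \<le> D + card I"
proof -
  note m = coupling_memD[OF assms(1,2)]
  have fS: "finite S"
    using m(1) by (rule finite_member)
  have "card (edge e S - R) \<le> card (S - R)"
    using edge_subset[OF m(1) assms(3)] fS by (intro card_mono) auto
  then show "card (edge e S - R) \<le> D"
    using m(3) by linarith
  have "card (R - edge e S) \<le> card ((R - S) \<union> (S - edge e S))"
    using m(2) fS by (intro card_mono) auto
  also have "\<dots> \<le> card (R - S) + card (S - edge e S)"
    by (rule card_Un_le)
  also have "\<dots> \<le> D + card I"
    using m(4) card_diff_edge[OF m(1)] by (intro add_mono) auto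
  finally show "card (R - edge e S) \<le> D + card I" .
qed

text \<open>Given \<open>R\<close>, the edge \<open>X = edge e S\<close> differs from \<open>R\<close> in few vertices, so few
  guesses recover which vertices of \<open>X - R\<close> carry labels in \<open>e\<close> and which vertices of \<open>R - X\<close>
  carry labels outside \<open>e\<close>.\<close>

lemma entropy_partial_view_le:
  assumes q: "coupling D q" and e: "e \<in> E"
  shows "entropy_of (partial_view e) q \<le> entropy_of (map_prod (edge e) id) q
    + 2 * real (card I) * ln (real (D + card I + 1))"
proof -
  \<comment> \<open>Two assignments are guessed, each giving every label \<open>None\<close> or one
    of at most D + d vertices.\<close>
  let ?d = "card I" let ?K = "(D + ?d + 1) ^ (2 * ?d)"
  have "entropy_of (partial_view e) q \<le> entropy_of (map_prod (edge e) id) q + ln (real ?K)"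
  proof (rule entropy_of_le_fibers)
    fix a assume a: "a \<in> set_pmf q"
    obtain S0 R where a_eq: "a = (S0, R)" by (cases a)
    define X where "X = edge e S0"
    have S0: "S0 \<in> \<S>" and finR: "finite R"
      using coupling_memD[OF q a[unfolded a_eq]] by auto
    have finX: "finite X"
      unfolding X_def using S0 e by (rule finite_edge)
    have cX: "card (X - R) \<le> D + ?d" "card (R - X) \<le> D + ?d"
      using card_sym_diff_edge[OF q a[unfolded a_eq] e] by (auto simp: X_def)
    define P where "P = (\<lambda>B :: 'a set. PiE_dflt I None (\<lambda>_. insert None (Some ` B)))"
    have P: "finite (P B)" "card (P B) \<le> (D + ?d + 1) ^ ?d"
      if "finite B" "card B \<le> D + ?d" for B
    proof -
      show "finite (P B)"
        unfolding P_def using finite_I that(1) by (intro finite_PiE_dflt) auto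
      have "card (P B) = (card B + 1) ^ ?d"
        unfolding P_def using finite_I that(1)
        by (subst card_PiE_dflt) (auto simp: card_image)
      also have "\<dots> \<le> (D + ?d + 1) ^ ?d"
        using that(2) by (intro power_mono) auto
      finally show "card (P B) \<le> (D + ?d + 1) ^ ?d" .
    qed
    define Q where "Q = P (X - R) \<times> P (R - X)"
    \<comment> \<open>To decode a guess, remove from \<open>X\<close> its labelled vertices outside
      \<open>R\<close> and add the labelled vertices of \<open>R\<close> missing from
      \<open>X\<close>. By \<open>notin_T\<close> the removal spares \<open>T S\<close>.\<close>
    define h where "h = (\<lambda>(k, l). (R, X - {x. Some x \<in> k ` I} \<union> {x. Some x \<in> l ` I}, k))"
    have finQ: "finite Q"
      unfolding Q_def using P cX finX finR by auto
    have "partial_view e ` {a' \<in> set_pmf q. map_prod (edge e) id a' = map_prod (edge e) id a} \<subseteq> h ` Q"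
    proof (rule image_subsetI)
      fix a' assume a': "a' \<in> {a' \<in> set_pmf q. map_prod (edge e) id a' = map_prod (edge e) id a}"
      obtain S R' where a'_eq: "a' = (S, R')" by (cases a')
      have SR: "(S, R') \<in> set_pmf q" and eq: "map_prod (edge e) id (S, R') = map_prod (edge e) id a"
        using a' by (simp_all add: a'_eq)
      have R': "R' = R" and XS: "X = T S \<union> f S ` e"
        using eq by (auto simp: a_eq X_def edge_def)
      have S: "S \<in> \<S>"
        using coupling_memD[OF q SR] by auto
      define l where "l = (\<lambda>i. if i \<in> I \<and> f S i \<in> R - X then Some (f S i) else None)"
      have eI: "e \<subseteq> I"
        using e by (rule E_sub)
      have "outer e S R \<in> P (X - R)"
        using eI by (auto simp: P_def PiE_dflt_def outer_def XS)
      moreover have "l \<in> P (R - X)"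
        by (auto simp: P_def PiE_dflt_def l_def)
      moreover have "core S R = X - {x. Some x \<in> outer e S R ` I} \<union> {x. Some x \<in> l ` I}"
      proof -
        have 1: "{x. Some x \<in> outer e S R ` I} = f S ` e - R"
          using eI by (auto simp: outer_def image_iff split: if_splits)
        have 2: "{x. Some x \<in> l ` I} = f S ` I \<inter> R - X"
          by (auto simp: l_def image_iff split: if_splits)
        show ?thesis
          unfolding 1 2 core_def XS using eI notin_T[OF S] by auto
      qed
      ultimately have "(outer e S R, l) \<in> Q" "partial_view e (S, R) = h (outer e S R, l)"
        by (auto simp: Q_def partial_view_def h_def)
      then show "partial_view e a' \<in> h ` Q"
        unfolding a'_eq R' by (intro image_eqI)
    qed
    then have "card (partial_view e ` {a' \<in> set_pmf q. map_prod (edge e) id a' = map_prod (edge e) id a})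
        \<le> card (h ` Q)"
      using finQ by (intro card_mono) auto
    also have "\<dots> \<le> card Q"
      using finQ by (rule card_image_le)
    also have "\<dots> \<le> (D + ?d + 1) ^ ?d * (D + ?d + 1) ^ ?d"
      unfolding Q_def card_cartesian_product
      using P cX finX finR by (intro mult_mono) auto
    also have "\<dots> = ?K"
      by (simp add: mult_2 power_add)
    finally show "card (partial_view e ` {a' \<in> set_pmf q. map_prod (edge e) id a' = map_prod (edge e) id a})
        \<le> ?K" .
  qed (use coupling_finite[OF q] in auto)
  also have "ln (real ?K) = 2 * real ?d * ln (real (D + ?d + 1))"
    unfolding of_nat_power by (subst ln_realpow) auto
  finally show ?thesis .
qed

text \<open>The entropy is monotone because a smaller view is a function \<open>u\<close> of a
  larger one. It is submodular because the views for \<open>A\<close> and \<open>B\<close> jointly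
  determine the view for the union, and each determines the view for the intersection.\<close>

lemma partial_view_shearer:
  assumes q: "coupling D q"
  shows "entropy_of (partial_view I) q + (sum w E - 1) * entropy_of (partial_view {}) q
    \<le> (\<Sum>e\<in>E. w e * entropy_of (partial_view e) q)"
proof (rule polymatroid_shearer[OF finite_I E_sub w_nonneg finite_E w_cover])
  note fin = coupling_finite[OF q]
  have restrict: "outer A S R = (\<lambda>i. if i \<in> A then outer B S R i else None)" if "A \<subseteq> B" for A B S R
    by (rule ext) (use that in \<open>auto simp: outer_def\<close>)
  define u where "u = (\<lambda>A (R :: 'a set, M :: 'a set, g :: 'i \<Rightarrow> 'a option).
    (R, M, \<lambda>i. if i \<in> A then g i else None))"
  have view: "partial_view A a = u A (partial_view B a)" if "A \<subseteq> B" for A B a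
    using restrict[OF that] by (auto simp: u_def partial_view_def split: prod.split)
  show "entropy_of (partial_view A) q \<le> entropy_of (partial_view B) q" if "A \<subseteq> B" for A B
    using fin by (rule entropy_of_le_determined) (simp add: view[OF that])
  fix A B
  have "entropy_of (partial_view (A \<union> B)) q
      \<le> entropy_of (\<lambda>a. (partial_view A a, partial_view B a)) q"
    using fin
  proof (rule entropy_of_le_determined)
    fix a b assume eq: "(partial_view A a, partial_view B a) = (partial_view A b, partial_view B b)"
    obtain S R S' R' where ab: "a = (S, R)" "b = (S', R')" by fastforce
    have *: "outer (A \<union> B) S R = (\<lambda>i. if i \<in> A then outer A S R i else outer B S R i)" for S R
      by (auto simp: outer_def)
    show "partial_view (A \<union> B) a = partial_view (A \<union> B) b"
    proof -
      have "R' = R" "core S' R = core S R" "outer A S' R = outer A S R" "outer B S' R = outer B S R"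
        using eq by (auto simp: ab partial_view_def)
      then show ?thesis
        by (simp add: ab partial_view_def * cong: if_cong)
    qed
  qed
  moreover have "entropy_of (\<lambda>a. (partial_view A a, partial_view B a)) q
      + entropy_of (partial_view (A \<inter> B)) q
      \<le> entropy_of (partial_view A) q + entropy_of (partial_view B) q"
    using fin by (rule entropy_of_submodular[where u = "u (A \<inter> B)" and v = "u (A \<inter> B)"])
      (auto intro!: view)
  ultimately show "entropy_of (partial_view (A \<union> B)) q + entropy_of (partial_view (A \<inter> B)) q
      \<le> entropy_of (partial_view A) q + entropy_of (partial_view B) q"
    by linarith
qed

text \<open>The full view determines \<open>S\<close>: a labelled vertex lies in \<open>R\<close>,
  hence in the core, or is a value of \<open>outer\<close>.\<close>

lemma pmf_entropy_le_partial_view: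
  assumes q: "coupling D q"
  shows "pmf_entropy q \<le> entropy_of (partial_view I) q"
proof -
  have "entropy_of (\<lambda>a. a) q \<le> entropy_of (partial_view I) q"
    using coupling_finite[OF q]
  proof (rule entropy_of_le_determined)
    have recover: "S = core S R \<union> {x. Some x \<in> range (outer I S R)}" if "(S, R) \<in> set_pmf q" for S R
    proof -
      have "S = T S \<union> f S ` I"
        using coupling_memD(1)[OF q that] by (rule decomp)
      moreover have "{x. Some x \<in> range (outer I S R)} = f S ` I - R"
        by (auto simp: outer_def image_iff split: if_splits)
      ultimately show ?thesis
        unfolding core_def by blast
    qed
    fix a b assume ab: "a \<in> set_pmf q" "b \<in> set_pmf q" and eq: "partial_view I a = partial_view I b"
    obtain S R S' R' where S: "a = (S, R)" "b = (S', R')"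
      by fastforce
    have *: "R' = R" "core S' R = core S R" "outer I S' R = outer I S R"
      using eq by (auto simp: partial_view_def S)
    have "S = core S R \<union> {x. Some x \<in> range (outer I S R)}"
      using ab S by (intro recover) simp
    also have "\<dots> = core S' R' \<union> {x. Some x \<in> range (outer I S' R')}"
      by (simp only: *)
    also have "\<dots> = S'"
      using ab S by (intro recover[symmetric]) simp
    finally show "a = b"
      using S *(1) by simp
  qed
  then show ?thesis
    by simp
qed

text \<open>Shearer's bound with edges in place of partial views, made relative to \<open>R\<close>:
  the coefficients of H(R) balance since rho - (rho - 1) = 1.\<close>

lemma cond_entropy_le:
  assumes q: "coupling D q"
  shows "cond_entropy q \<le> (\<Sum>e\<in>E. w e * (entropy_of (map_prod (edge e) id) q - entropy_of snd q))
    - (sum w E - 1) * (entropy_of (partial_view {}) q - entropy_of snd q)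
    + sum w E * (2 * real (card I) * ln (real (D + card I + 1)))"
proof -
  let ?k = "2 * real (card I) * ln (real (D + card I + 1))"
  have "(\<Sum>e\<in>E. w e * entropy_of (partial_view e) q)
      \<le> (\<Sum>e\<in>E. w e * (entropy_of (map_prod (edge e) id) q + ?k))"
    by (intro sum_mono mult_left_mono entropy_partial_view_le[OF q] w_nonneg)
  also have "\<dots> = (\<Sum>e\<in>E. w e * (entropy_of (map_prod (edge e) id) q - entropy_of snd q))
      + sum w E * entropy_of snd q + sum w E * ?k"
    by (simp add: distrib_left right_diff_distrib sum.distrib sum_subtractf sum_distrib_right)
  finally show ?thesis
    using pmf_entropy_le_partial_view[OF q] partial_view_shearer[OF q]
    unfolding cond_entropy_def by (simp add: algebra_simps)
qed

section \<open>Two moves on couplings: resampling given an edge, and replacing the reference set by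
  the core\<close>

text \<open>The new member contains the same edge as the old one and exceeds it by at most d
  vertices, so comparing it with \<open>R\<close> through this edge costs at most d in each
  direction.\<close>

lemma coupling_resample:
  assumes q: "coupling D q" and e: "e \<in> E"
  shows "coupling (D + card I) (resample (edge e) q)"
proof -
  have "set_pmf (resample (edge e) q) \<subseteq> fst ` set_pmf q \<times> snd ` set_pmf q"
    unfolding set_pmf_resample by force
  then have fin: "finite (set_pmf (resample (edge e) q))"
    by (rule finite_subset) (use coupling_finite[OF q] in auto)
  have "finite R \<and> card (S' - R) \<le> D + card I \<and> card (R - S') \<le> D + card I"
    if "(S', R) \<in> set_pmf (resample (edge e) q)" for S' R
  proof -
    from that obtain S where S: "(S, R) \<in> set_pmf q" "S' \<in> fst ` set_pmf q" "edge e S' = edge e S"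
      unfolding set_pmf_resample by auto
    have S': "S' \<in> \<S>"
      using S(2) coupling_fst[OF q] by simp
    have finR: "finite R" and finS': "finite S'"
      using coupling_memD[OF q S(1)] finite_member[OF S'] by auto
    note c = card_sym_diff_edge[OF q S(1) e, folded S(3)]
    have "card (S' - R) \<le> card ((edge e S' - R) \<union> (S' - edge e S'))"
      using finite_edge[OF S' e] finS' by (intro card_mono) auto
    also have "\<dots> \<le> card (edge e S' - R) + card (S' - edge e S')"
      by (rule card_Un_le)
    also have "\<dots> \<le> D + card I"
      using c(1) card_diff_edge[OF S'] by (intro add_mono) auto
    finally have 1: "card (S' - R) \<le> D + card I" .
    have "card (R - S') \<le> card (R - edge e S')"
      using finR edge_subset[OF S' e] by (intro card_mono) auto
    then show ?thesis
      using 1 c(2) finR by simp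
  qed
  then show ?thesis
    using fin q by (auto simp: coupling_def map_fst_resample)
qed

text \<open>Since \<open>R\<close> keeps its law, the chain rule gives the new conditional entropy
  as H(X | R) + H(S) - H(X) for the edge X, and H(X) is at most the log of the number of available
  edges.\<close>

lemma cond_entropy_resample:
  assumes q: "coupling D q" and e: "e \<in> E"
  shows "entropy_of (map_prod (edge e) id) q - entropy_of snd q
    + ln (real (card \<S>)) - ln (real (card \<G>)) \<le> cond_entropy (resample (edge e) q)"
proof -
  have "set_pmf (map_pmf (edge e \<circ> fst) q) \<subseteq> \<G>"
    using coupling_fst[OF q] in_G[OF _ e] by (force simp: edge_def)
  then have "entropy_of (edge e \<circ> fst) q \<le> ln (real (card \<G>))"
    by (rule pmf_entropy_le_ln_card[OF finite_G])
  then show ?thesis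
    using pmf_entropy_resample[OF coupling_finite[OF q], of "edge e"] entropy_fst[OF q]
    by (simp add: cond_entropy_def map_snd_resample)
qed

text \<open>The core is a subset of \<open>S\<close> missing at most d vertices, whatever
  \<open>D\<close> was.\<close>

lemma coupling_core:
  assumes q: "coupling D q"
  shows "coupling (card I) (map_pmf (\<lambda>(S, R). (S, core S R)) q)"
proof -
  have "finite (core S R) \<and> card (S - core S R) \<le> card I \<and> card (core S R - S) \<le> card I"
    if "(S, R) \<in> set_pmf q" for S R
  proof -
    have S: "S \<in> \<S>"
      using coupling_memD[OF q that] by auto
    have sub: "core S R \<subseteq> S"
      unfolding core_def using decomp[OF S] by blast
    have "S - core S R \<subseteq> S - edge {} S"
      unfolding core_def edge_def by blast
    then have "card (S - core S R) \<le> card (S - edge {} S)"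
      using finite_member[OF S] by (intro card_mono) auto
    also have "\<dots> \<le> card I"
      using S by (rule card_diff_edge)
    finally show ?thesis
      using finite_subset[OF sub finite_member[OF S]] sub by (simp add: Diff_eq_empty_iff[THEN iffD2])
  qed
  then show ?thesis
    using q by (auto simp: coupling_def map_pmf_comp split_def)
qed

text \<open>With M the core, a function of \<open>S\<close> and \<open>R\<close>, the left side is
  H(S | R, M), which is at most H(S | M).\<close>

lemma cond_entropy_core:
  assumes q: "coupling D q"
  shows "pmf_entropy q - entropy_of (partial_view {}) q
    \<le> cond_entropy (map_pmf (\<lambda>(S, R). (S, core S R)) q)"
proof -
  note fin = coupling_finite[OF q]
  let ?X = "\<lambda>a. (fst a, core (fst a) (snd a))" and ?Z = "\<lambda>a. core (fst a) (snd a)"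
  have "entropy_of (\<lambda>a. a) q \<le> entropy_of (\<lambda>a. (?X a, partial_view {} a)) q"
    using fin by (rule entropy_of_le_determined) (auto simp: partial_view_def split_def prod_eq_iff)
  moreover have "entropy_of (\<lambda>a. (?X a, partial_view {} a)) q + entropy_of ?Z q
      \<le> entropy_of ?X q + entropy_of (partial_view {}) q"
    using fin by (rule entropy_of_submodular[where u = snd and v = "fst \<circ> snd"])
      (auto simp: partial_view_def)
  moreover have "map_pmf (\<lambda>(S, R). (S, core S R)) q = map_pmf ?X q"
    by (simp add: split_def)
  ultimately show ?thesis
    by (simp add: cond_entropy_def map_pmf_comp)
qed

lemma cond_entropy_le_ln_card:
  assumes q: "coupling D q"
  shows "cond_entropy q \<le> ln (real (card \<S>))"
proof -
  have "entropy_of (\<lambda>a. (fst a, snd a)) q + entropy_of (\<lambda>_. ()) q \<le> entropy_of fst q + entropy_of snd q"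
    using coupling_finite[OF q]
    by (rule entropy_of_submodular[where u = "\<lambda>_. ()" and v = "\<lambda>_. ()"]) auto
  then show ?thesis
    using entropy_fst[OF q] by (simp add: cond_entropy_def)
qed

lemma coupling_diagonal: "coupling 0 (map_pmf (\<lambda>S. (S, S)) (pmf_of_set \<S>))"
  using finite_S S_nonempty finite_member by (auto simp: coupling_def map_pmf_comp)

text \<open>Take a coupling that nearly maximizes \<open>H(S | R) - c * ln (D + d + 1)\<close>. That resampling
  does not improve it bounds the entropy of each edge given \<open>R\<close> from above; that replacing \<open>R\<close>
  by \<open>core S R\<close>, which resets \<open>D\<close> to \<open>d\<close>, does not improve it bounds the entropy of the core
  given \<open>R\<close> from below, by enough to pay for the term in \<open>ln (D + d + 1)\<close> of
  \<open>cond_entropy_le\<close>.\<close>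

lemma ln_card_le:
  assumes c: "0 \<le> c" "2 * real (card I) * sum w E \<le> c * (sum w E - 1)"
    and rho: "1 \<le> sum w E"
  shows "ln (real (card \<S>)) \<le> sum w E * ln (real (card \<G>))
    + sum w E * (c * ln 2 + 1) + (sum w E - 1) * (c * ln (real (2 * card I + 1)) + 1)"
proof -
  let ?d = "card I" and ?\<rho> = "sum w E"
  define \<Phi> where "\<Phi> = (\<lambda>D q. cond_entropy q - c * ln (real (D + ?d + 1)))"
  define V where "V = {\<Phi> D q | D q. coupling D q}"
  have V: "V \<noteq> {}"
    unfolding V_def using coupling_diagonal by blast
  have bdd: "bdd_above V"
  proof (rule bdd_aboveI)
    fix v assume "v \<in> V"
    then obtain D q where q: "coupling D q" and v: "v = \<Phi> D q"
      unfolding V_def by blast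
    have "0 \<le> c * ln (real (D + ?d + 1))"
      using c by (intro mult_nonneg_nonneg) auto
    then show "v \<le> ln (real (card \<S>))"
      using cond_entropy_le_ln_card[OF q] by (simp add: v \<Phi>_def)
  qed
  have "\<exists>v\<in>V. Sup V - 1 < v"
    using V by (rule less_cSupD) simp
  \<comment> \<open>Coming within 1 of the supremum is enough; this slack is the source of the
    summands 1 in the bound.\<close>
  then obtain D q where q: "coupling D q" and qmax: "Sup V - 1 < \<Phi> D q"
    unfolding V_def by blast
  have max: "\<Phi> D' q' \<le> \<Phi> D q + 1" if "coupling D' q'" for D' q'
  proof -
    have "\<Phi> D' q' \<le> Sup V"
      unfolding V_def by (rule cSup_upper[OF _ bdd[unfolded V_def]]) (use that in blast)
    then show ?thesis
      using qmax by linarith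
  qed
  define L where "L = ln (real (D + ?d + 1))"
  have L: "0 \<le> L"
    by (simp add: L_def)
  define \<kappa> where "\<kappa> = cond_entropy q"
  define N where "N = ln (real (card \<S>))"
  define n where "n = ln (real (card \<G>))"
  define h where "h = entropy_of (partial_view {}) q - entropy_of snd q"
  have move: "entropy_of (map_prod (edge e) id) q - entropy_of snd q \<le> \<kappa> - N + n + (c * ln 2 + 1)"
    if e: "e \<in> E" for e
  proof -
    \<comment> \<open>Resampling raises \<open>D\<close> by d, which at most doubles D + d +
      1.\<close>
    have "ln (real (D + ?d + ?d + 1)) \<le> ln (2 * real (D + ?d + 1))"
      by (intro ln_mono) auto
    also have "\<dots> = ln 2 + L"
      unfolding L_def by (subst ln_mult) auto
    finally have "c * ln (real (D + ?d + ?d + 1)) \<le> c * (ln 2 + L)"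
      using c(1) by (rule mult_left_mono)
    also have "\<dots> = c * ln 2 + c * L"
      by (rule distrib_left)
    finally have "c * ln (real (D + ?d + ?d + 1)) \<le> c * ln 2 + c * L" .
    then show ?thesis
      using max[OF coupling_resample[OF q e]] cond_entropy_resample[OF q e]
      by (simp add: \<Phi>_def \<kappa>_def N_def n_def L_def)
  qed
  have "cond_entropy q - h \<le> \<Phi> D q + 1 + c * ln (real (2 * ?d + 1))"
    using max[OF coupling_core[OF q]] cond_entropy_core[OF q]
    by (simp add: \<Phi>_def h_def cond_entropy_def)
  then have reset: "c * L - (c * ln (real (2 * ?d + 1)) + 1) \<le> h"
    by (simp add: \<Phi>_def L_def)
  have "(\<Sum>e\<in>E. w e * (entropy_of (map_prod (edge e) id) q - entropy_of snd q))
      \<le> (\<Sum>e\<in>E. w e * (\<kappa> - N + n + (c * ln 2 + 1)))"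
    by (intro sum_mono mult_left_mono move w_nonneg)
  also have "\<dots> = ?\<rho> * (\<kappa> - N + n + (c * ln 2 + 1))"
    by (simp add: sum_distrib_right)
  finally have "\<kappa> \<le> ?\<rho> * (\<kappa> - N + n + (c * ln 2 + 1)) - (?\<rho> - 1) * h + ?\<rho> * (2 * real ?d * L)"
    using cond_entropy_le[OF q] by (simp add: \<kappa>_def h_def L_def)
  \<comment> \<open>After substituting for \<open>h\<close>, the hypothesis on \<open>c\<close>
    makes the terms in \<open>L\<close> drop out. What is left bounds rho * N by (rho - 1) * kappa
    plus the desired right side, and kappa <= N finishes.\<close>
  moreover have "(?\<rho> - 1) * (c * L - (c * ln (real (2 * ?d + 1)) + 1)) \<le> (?\<rho> - 1) * h"
    using reset rho by (intro mult_left_mono) auto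
  moreover have "2 * real ?d * ?\<rho> * L \<le> c * (?\<rho> - 1) * L"
    using c(2) L by (rule mult_right_mono)
  moreover have "(?\<rho> - 1) * \<kappa> \<le> (?\<rho> - 1) * N"
    using cond_entropy_le_ln_card[OF q] rho by (intro mult_left_mono) (auto simp: \<kappa>_def N_def)
  ultimately show ?thesis
    unfolding N_def[symmetric] n_def[symmetric] by (simp add: algebra_simps)
qed

section \<open>Lower bounds on the total weight of a cover\<close>

lemma one_le_sum_w:
  assumes "I \<noteq> {}"
  shows "1 \<le> sum w E"
proof -
  from assms obtain i where "i \<in> I" by auto
  then have "1 \<le> (\<Sum>e\<in>{e \<in> E. i \<in> e}. w e)"
    by (rule w_cover)
  also have "\<dots> \<le> sum w E"
    using finite_E w_nonneg by (intro sum_mono2) auto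
  finally show ?thesis .
qed

text \<open>Sum the covering conditions over \<open>I\<close>: every edge is a proper subset, so its
  weight is counted at most d - 1 times. This keeps the total weight away from 1.\<close>

lemma card_le_sum_w:
  assumes "I \<notin> E"
  shows "real (card I) \<le> (real (card I) - 1) * sum w E"
proof -
  have "real (card I) \<le> (\<Sum>i\<in>I. \<Sum>e\<in>{e \<in> E. i \<in> e}. w e)"
    using sum_mono[OF w_cover, of I "\<lambda>i. i"] by simp
  also have "\<dots> = (\<Sum>e\<in>E. \<Sum>i\<in>{i \<in> I. i \<in> e}. w e)"
    using finite_I finite_E by (rule sum.swap_restrict)
  also have "\<dots> \<le> (\<Sum>e\<in>E. (real (card I) - 1) * w e)"
  proof (rule sum_mono)
    fix e assume e: "e \<in> E"
    then have "e \<subset> I"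
      using assms E_sub by blast
    then have "card e < card I"
      using finite_I by (rule psubset_card_mono[rotated])
    then have "real (card e) * w e \<le> (real (card I) - 1) * w e"
      using w_nonneg[OF e] by (intro mult_right_mono) auto
    moreover have "{i \<in> I. i \<in> e} = e"
      using E_sub[OF e] by auto
    ultimately show "(\<Sum>i\<in>{i \<in> I. i \<in> e}. w e) \<le> (real (card I) - 1) * w e"
      by simp
  qed
  finally show ?thesis
    by (simp add: sum_distrib_left)
qed

text \<open>The error term uses an upper bound \<open>P\<close> for the total weight, so that it
  does not depend on the chosen cover.\<close>

lemma ln_card_le_cover:
  assumes I: "I \<noteq> {}" and P: "sum w E \<le> P"
  shows "ln (real (card \<S>)) \<le> sum w E * ln (real (card \<G>))
    + 2 * P * (2 * (real (card I))\<^sup>2 * ln (real (2 * card I + 1)) + 1)"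
proof -
  let ?d = "card I" and ?\<rho> = "sum w E"
  \<comment> \<open>If \<open>I\<close> is not an edge then rho <= d * (rho - 1); multiplying by 2 *
    d gives the condition on \<open>c\<close> in \<open>ln_card_le\<close>.\<close>
  let ?c = "2 * (real ?d)\<^sup>2"
  note rho = one_le_sum_w[OF I]
  have d: "1 \<le> ?d"
    using I finite_I by (simp add: Suc_le_eq card_gt_0_iff)
  have K: "0 \<le> ?c * ln (real (2 * ?d + 1))"
    by simp
  show ?thesis
  proof (cases "I \<in> E")
    case True
    have "\<S> \<subseteq> \<G>"
      using in_G[OF _ True] decomp by auto
    then have "card \<S> \<le> card \<G>"
      using finite_G by (rule card_mono[rotated])
    moreover have "0 < card \<S>"
      using finite_S S_nonempty by (simp add: card_gt_0_iff)
    ultimately have "ln (real (card \<S>)) \<le> 1 * ln (real (card \<G>))"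
      by (simp add: ln_mono)
    also have "\<dots> \<le> ?\<rho> * ln (real (card \<G>))"
      using rho \<open>card \<S> \<le> card \<G>\<close> \<open>0 < card \<S>\<close> by (intro mult_right_mono) auto
    finally show ?thesis
      using K P rho by (smt (verit) mult_nonneg_nonneg)
  next
    case False
    have "?\<rho> \<le> real ?d * (?\<rho> - 1)"
      using card_le_sum_w[OF False] by (simp add: algebra_simps)
    then have "2 * real ?d * ?\<rho> \<le> 2 * real ?d * (real ?d * (?\<rho> - 1))"
      by (intro mult_left_mono) auto
    then have c: "2 * real ?d * ?\<rho> \<le> ?c * (?\<rho> - 1)"
      by (simp add: power2_eq_square algebra_simps)
    have "ln (real (card \<S>)) \<le> ?\<rho> * ln (real (card \<G>))
        + ?\<rho> * (?c * ln 2 + 1) + (?\<rho> - 1) * (?c * ln (real (2 * ?d + 1)) + 1)"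
      using c rho by (intro ln_card_le) auto
    \<comment> \<open>Both rho and rho - 1 are at most \<open>P\<close>, and ln 2 <= ln (2 * d + 1)
      as d >= 1.\<close>
    also have "\<dots> \<le> ?\<rho> * ln (real (card \<G>))
        + P * (?c * ln (real (2 * ?d + 1)) + 1) + P * (?c * ln (real (2 * ?d + 1)) + 1)"
      using P K d rho
      by (intro add_mono mult_mono order_refl mult_left_mono) auto
    finally show ?thesis
      by (simp add: algebra_simps)
  qed
qed

end

section \<open>Copies of cones\<close>

text \<open>\<open>S\<close> has exactly d + t elements, so an embedding into it is onto.\<close>

lemma cone_copy_labelling:
  assumes H: "verts H = {1..d}" and G: "hypergraph G" and S: "S \<in> copy_sets G (cone t H)"
  obtains f where "inj_on f {1..d + t}" "f ` {1..d + t} = S"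
    "\<forall>e\<in>#edges H. f ` {d + 1..d + t} \<union> f ` e \<in># edges G"
proof -
  have cone: "verts (cone t H) = {1..d + t}"
    "edges (cone t H) = image_mset (\<lambda>e. e \<union> {d + 1..d + t}) (edges H)"
    by (simp_all add: cone_def Let_def H)
  from S have sub: "S \<subseteq> verts G" and card: "card S = d + t"
    and copy: "contains_copy (induced G S) (cone t H)"
    by (simp_all add: copy_sets_def cone)
  have finS: "finite S"
    using sub G finite_subset by (auto simp: hypergraph_def)
  from copy obtain f where inj: "inj_on f {1..d + t}" and fS: "f ` {1..d + t} \<subseteq> S"
    and emb: "image_mset ((`) f) (edges (cone t H)) \<subseteq># edges (induced G S)"
    unfolding contains_copy_def cone(1) by (auto simp: induced_def)
  have "f ` {1..d + t} = S"
    using finS fS card card_image[OF inj] by (intro card_subset_eq) auto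
  moreover have "f ` {d + 1..d + t} \<union> f ` e \<in># edges G" if "e \<in># edges H" for e
  proof -
    have "f ` (e \<union> {d + 1..d + t}) \<in># image_mset ((`) f) (edges (cone t H))"
      using that by (auto simp: cone(2))
    then have "f ` (e \<union> {d + 1..d + t}) \<in># edges (induced G S)"
      using emb by (rule mset_subset_eqD[rotated])
    then show ?thesis
      by (simp add: induced_def image_Un Un_commute)
  qed
  ultimately show ?thesis
    using that inj by blast
qed

section \<open>Weighted sums over the edges of a simple hypergraph\<close>

lemma simple_edges: "simple H \<Longrightarrow> edges H = mset_set (set_mset (edges H))"
  by (intro multiset_eqI) (auto simp: simple_def count_mset_set' le_Suc_eq count_eq_zero_iff)

lemma sum_mset_simple: "simple H \<Longrightarrow> (\<Sum>e\<in>#edges H. w e) = (\<Sum>e\<in>set_mset (edges H). w e)"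
  unfolding sum_unfold_sum_mset by (simp flip: simple_edges)

lemma sum_mset_filter_simple:
  assumes "simple H"
  shows "(\<Sum>e\<in>#filter_mset P (edges H). w e) = (\<Sum>e\<in>{e \<in> set_mset (edges H). P e}. w e)"
proof -
  have "filter_mset P (edges H) = mset_set {e \<in> set_mset (edges H). P e}"
    by (subst simple_edges[OF assms]) (simp add: filter_mset_mset_set)
  then show ?thesis
    by (simp add: sum_unfold_sum_mset)
qed

lemma ln_card_copy_sets_cone_le:
  assumes d: "d \<ge> 1" and H: "hypergraph H" "verts H = {1..d}" "simple H"
    and w: "fractional_edge_cover H w" and P: "(\<Sum>e\<in>#edges H. w e) \<le> P"
    and G: "hypergraph G" and nonempty: "copy_sets G (cone t H) \<noteq> {}"
  shows "ln (real (card (copy_sets G (cone t H))))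
    \<le> (\<Sum>e\<in>#edges H. w e) * ln (real (card (set_mset (edges G))))
      + 2 * P * (2 * (real d)\<^sup>2 * ln (real (2 * d + 1)) + 1)"
proof -
  let ?S = "copy_sets G (cone t H)"
  define labels where "labels = (\<lambda>S f. inj_on f {1..d + t} \<and> f ` {1..d + t} = S \<and>
    (\<forall>e\<in>#edges H. f ` {d + 1..d + t} \<union> f ` e \<in># edges G))"
  have "\<exists>f. labels S f" if S: "S \<in> ?S" for S
  proof -
    obtain f where "inj_on f {1..d + t}" "f ` {1..d + t} = S"
      "\<forall>e\<in>#edges H. f ` {d + 1..d + t} \<union> f ` e \<in># edges G"
      using cone_copy_labelling[OF H(2) G S] .
    then have "labels S f"
      unfolding labels_def by (intro conjI)
    then show ?thesis
      by auto
  qed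
  then obtain f where labels: "\<And>S. S \<in> ?S \<Longrightarrow> labels S (f S)"
    by metis
  have f: "inj_on (f S) {1..d + t}" "f S ` {1..d + t} = S"
      "\<And>e. e \<in># edges H \<Longrightarrow> f S ` {d + 1..d + t} \<union> f S ` e \<in># edges G" if "S \<in> ?S" for S
    using labels[OF that] unfolding labels_def by blast+
  have split: "{1..d + t} = {d + 1..d + t} \<union> {1..d}"
    by auto
  interpret labelled_family "{1..d}" "set_mset (edges H)" w ?S "set_mset (edges G)"
    "\<lambda>S. f S ` {d + 1..d + t}" f
  proof
    have fin: "finite (verts G)"
      using G by (simp add: hypergraph_def)
    then show "finite ?S"
      by (rule finite_subset[rotated, OF finite_Pow_iff[THEN iffD2]]) (auto simp: copy_sets_def)
    show "finite S" if "S \<in> ?S" for S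
      using that fin finite_subset by (auto simp: copy_sets_def)
    show "S = f S ` {d + 1..d + t} \<union> f S ` {1..d}" if "S \<in> ?S" for S
      using f(2)[OF that] unfolding split image_Un by (rule sym)
    show "f S i \<notin> f S ` {d + 1..d + t}" if "S \<in> ?S" "i \<in> {1..d}" for S i
      using inj_on_image_mem_iff[OF f(1)[OF that(1)], of i "{d + 1..d + t}"] that(2) by auto
    show "f S ` {d + 1..d + t} \<union> f S ` e \<in> set_mset (edges G)"
      if "S \<in> ?S" "e \<in> set_mset (edges H)" for S e
      by (rule f(3)) (use that in auto)
    show "0 \<le> w e" if "e \<in> set_mset (edges H)" for e
      using w that by (auto simp: fractional_edge_cover_def)
    show "1 \<le> (\<Sum>e\<in>{e \<in> set_mset (edges H). i \<in> e}. w e)" if "i \<in> {1..d}" for i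
      using w that by (simp add: fractional_edge_cover_def H sum_mset_filter_simple)
    show "e \<subseteq> {1..d}" if "e \<in> set_mset (edges H)" for e
      using that H by (auto simp: hypergraph_def)
  qed (use nonempty in auto)
  show ?thesis
    using ln_card_le_cover[of P] d P H(3) by (simp add: sum_mset_simple)
qed

section \<open>From single covers to the covering number\<close>

lemma exists_fractional_edge_cover:
  assumes "hypergraph H" "simple H" "\<nexists>v. isolated H v"
  shows "fractional_edge_cover H (\<lambda>_. 1)"
  unfolding fractional_edge_cover_def
proof (intro conjI ballI)
  fix v assume v: "v \<in> verts H"
  then obtain e where "e \<in># edges H" "v \<in> e"
    using assms(3) by (auto simp: isolated_def)
  then have "{e \<in> set_mset (edges H). v \<in> e} \<noteq> {}"
    by auto
  then show "(1 :: real) \<le> (\<Sum>e\<in>#filter_mset (\<lambda>e. v \<in> e) (edges H). 1)"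
    unfolding sum_mset_filter_simple[OF assms(2)] by (simp add: Suc_le_eq card_gt_0_iff)
qed simp

theorem theorem1p6:
  fixes d :: nat and H :: "nat hypergraph"
  assumes "d \<ge> 1"
    and "hypergraph H" and "verts H = {1..d}"
    and "simple H"
    and "\<nexists>v. isolated H v"
  shows "\<exists>C::real. \<forall>t::nat. \<forall>n::nat. n \<ge> 1 \<longrightarrow>
    ereal_of_enat (max_copies (cone t H) n)
      \<le> ereal (C * real n powr fractional_edge_cover_number H)"
proof -
  define \<rho> where "\<rho> = fractional_edge_cover_number H"
  \<comment> \<open>This is the error term for \<open>P = \<rho> + 1\<close>: the infimum is only
    approached, by covers of weight at most rho + 1.\<close>
  define K where "K = 2 * (\<rho> + 1) * (2 * (real d)\<^sup>2 * ln (real (2 * d + 1)) + 1)"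
  have near: "\<exists>w. fractional_edge_cover H w \<and> (\<Sum>e\<in>#edges H. w e) < \<rho> + \<epsilon>" if "0 < \<epsilon>" for \<epsilon>
  proof -
    let ?V = "{(\<Sum>e\<in>#edges H. w e) | w. fractional_edge_cover H w}"
    have "?V \<noteq> {}"
      using exists_fractional_edge_cover[OF assms(2,4,5)] by blast
    moreover have "Inf ?V < \<rho> + \<epsilon>"
      using that by (simp add: \<rho>_def fractional_edge_cover_number_def)
    ultimately have "\<exists>x\<in>?V. x < \<rho> + \<epsilon>"
      by (rule cInf_lessD)
    then show ?thesis
      by blast
  qed
  have bound: "real (card (copy_sets G (cone t H))) \<le> exp K * real n powr \<rho>"
    if n: "n \<ge> 1" and G: "hypergraph G" "size (edges G) = n" for t n and G :: "nat hypergraph"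
  proof (cases "copy_sets G (cone t H) = {}")
    case False
    let ?N = "card (copy_sets G (cone t H))"
    let ?n = "card (set_mset (edges G))"
    have "?n \<le> n"
      using size_mset_mono[OF mset_set_set_mset_msubset[of "edges G"]] G(2) by simp
    then have ln_n: "ln (real ?n) \<le> ln (real n)"
    \<comment> \<open>By convention \<open>ln 0 = 0\<close>, so the case \<open>?n = 0\<close>
      reduces to ln n >= 0.\<close>
    proof (cases "?n = 0")
      case False
      then show ?thesis
        using \<open>?n \<le> n\<close> by (intro ln_mono) (auto simp: card_gt_0_iff)
    qed (use n in simp)
    have "ln (real ?N) \<le> \<rho> * ln (real n) + K + \<delta>" if \<delta>: "0 < \<delta>" for \<delta>
    proof -
      \<comment> \<open>The minimum with 1 keeps the cover weight below rho + 1, so \<open>K\<close>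
        serves every \<open>\<delta>\<close>; the summand 1 keeps the denominator positive at n =
        1.\<close>
      define \<epsilon> where "\<epsilon> = min 1 (\<delta> / (ln (real n) + 1))"
      have n0: "0 \<le> ln (real n)"
        using n by simp
      have eps: "0 < \<epsilon>" "\<epsilon> \<le> 1" "\<epsilon> * ln (real n) \<le> \<delta>"
      proof -
        show "0 < \<epsilon>" "\<epsilon> \<le> 1"
          using \<delta> n0 by (auto simp: \<epsilon>_def)
        have "\<epsilon> * ln (real n) \<le> \<delta> / (ln (real n) + 1) * ln (real n)"
          using n0 by (intro mult_right_mono) (auto simp: \<epsilon>_def)
        also have "\<dots> \<le> \<delta>"
          using \<delta> n0 by (simp add: field_simps)
        finally show "\<epsilon> * ln (real n) \<le> \<delta>" .
      qed
      obtain w where w: "fractional_edge_cover H w" and less: "(\<Sum>e\<in>#edges H. w e) < \<rho> + \<epsilon>"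
        using near[OF eps(1)] by blast
      have nonneg: "0 \<le> (\<Sum>e\<in>#edges H. w e)"
        using w by (auto simp: sum_mset_simple[OF assms(4)] fractional_edge_cover_def intro!: sum_nonneg)
      have "ln (real ?N) \<le> (\<Sum>e\<in>#edges H. w e) * ln (real ?n) + K"
        unfolding K_def using less eps(2)
        by (intro ln_card_copy_sets_cone_le assms w G False) simp
      also have "(\<Sum>e\<in>#edges H. w e) * ln (real ?n) \<le> (\<Sum>e\<in>#edges H. w e) * ln (real n)"
        using ln_n nonneg by (rule mult_left_mono)
      also have "\<dots> \<le> (\<rho> + \<epsilon>) * ln (real n)"
        using less n0 by (intro mult_right_mono) auto
      also have "\<dots> \<le> \<rho> * ln (real n) + \<delta>"
        using eps(3) by (simp add: distrib_right)
      finally show ?thesis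
        by simp
    qed
    then have "ln (real ?N) \<le> \<rho> * ln (real n) + K"
      by (rule field_le_epsilon)
    moreover have "finite (copy_sets G (cone t H))"
      using G(1) by (rule_tac finite_subset[of _ "Pow (verts G)"]) (auto simp: copy_sets_def hypergraph_def)
    ultimately have "real ?N \<le> exp (\<rho> * ln (real n) + K)"
      using False by (simp add: card_gt_0_iff flip: exp_le_cancel_iff[of "ln (real ?N)"])
    also have "\<dots> = exp K * real n powr \<rho>"
      using n by (simp add: powr_def exp_add mult.commute)
    finally show ?thesis .
  qed simp
  show ?thesis
  proof (intro exI allI impI)
    fix t n :: nat assume n: "n \<ge> 1"
    let ?x = "exp K * real n powr \<rho>"
    \<comment> \<open>Every count is an integer, so the real bound passes through the supremum in
      \<open>enat\<close> as its floor.\<close>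
    have "max_copies (cone t H) n \<le> enat (nat \<lfloor>?x\<rfloor>)"
      unfolding max_copies_def
      using bound[OF n] by (intro SUP_least) (auto simp: le_nat_floor)
    then have "ereal_of_enat (max_copies (cone t H) n) \<le> ereal_of_enat (enat (nat \<lfloor>?x\<rfloor>))"
      by (simp only: ereal_of_enat_le_iff)
    also have "\<dots> \<le> ereal ?x"
      by (simp add: of_nat_floor)
    finally show "ereal_of_enat (max_copies (cone t H) n)
        \<le> ereal (exp K * real n powr fractional_edge_cover_number H)"
      by (simp add: \<rho>_def)
  qed
qed

end
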